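(* Let $\mathbf u_0,\mathbf u_1\in\Lambda_q$ with $\mathbf u_0\wedge\mathbf u_1=1$. Start with the list $L_0=(\mathbf u_0,\mathbf u_1)$, and for $n\ge0$ obtain $L_{n+1}$ from $L_n$ by replacing every pair $(\mathbf v,\mathbf w)$ of consecutive entries of $L_n$ by the $q$ vectors $x_j^q\mathbf v+y_j^q\mathbf w$, $j=0,1,\dots,q-1$ (the first and last being $\mathbf v$ and $\mathbf w$ themselves; shared endpoints are listed once). Then for every $n\ge0$, every entry of $L_n$ lies in $\Lambda_q$ and in the sector $\{\alpha\mathbf u_0+\beta\mathbf u_1:\alpha,\beta\ge0\}$, and every pair $(\mathbf v,\mathbf w)$ of consecutive entries of $L_n$ satisfies $\mathbf v\wedge\mathbf w=1$. Moreover, every element of $\Lambda_q$ lying in the sector $\{\alpha\mathbf u_0+\beta\mathbf u_1:\alpha,\beta\ge0\}$ appears in $L_n$ for some $n$.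
   Context: Fix an integer $q\ge3$, let $\lambda_q=2\cos(\pi/q)$, and let $G_q\subset \mathrm{SL}(2,\mathbb R)$ be the Hecke triangle group generated by $S=\begin{pmatrix}0&-1\\1&0\end{pmatrix}$ and $T_q=\begin{pmatrix}1&\lambda_q\\0&1\end{pmatrix}$, acting linearly on $\mathbb R^2$. Set $\Lambda_q=G_q(1,0)^T$. Let $U_q=T_qS=\begin{pmatrix}\lambda_q&-1\\1&0\end{pmatrix}$ and $(x_j^q,y_j^q)^T=U_q^j(1,0)^T$ for $j=0,\dots,q-1$. The wedge product is $(x_0,y_0)^T\wedge(x_1,y_1)^T=x_0y_1-x_1y_0$. The vectors appearing in some $L_n$ other than $\mathbf u_0,\mathbf u_1$ are called the ($G_q$-Stern–Brocot) grandchildren of $\mathbf u_0,\mathbf u_1$. *)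

theory Defs
  imports "HOL-Analysis.Analysis"
begin

text \<open>Vectors of R^2 are \<open>real^2\<close>, 2x2 real matrices are \<open>real^2^2\<close> (rows first).\<close>

definition lambda_q :: "nat \<Rightarrow> real" where
  "lambda_q q = 2 * cos (pi / real q)"

definition S_mat :: "real^2^2" where
  "S_mat = vector [vector [0, -1], vector [1, 0]]"

definition T_mat :: "nat \<Rightarrow> real^2^2" where
  "T_mat q = vector [vector [1, lambda_q q], vector [0, 1]]"

text \<open>The Hecke triangle group G_q: the subgroup of SL(2,R) generated by S and T_q,
  i.e. all finite products of S, T_q and their inverses.\<close>
inductive_set hecke_group :: "nat \<Rightarrow> (real^2^2) set" for q :: nat where
  id_in: "mat 1 \<in> hecke_group q"
| S_in: "M \<in> hecke_group q \<Longrightarrow> S_mat ** M \<in> hecke_group q"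
| S_inv_in: "M \<in> hecke_group q \<Longrightarrow> matrix_inv S_mat ** M \<in> hecke_group q"
| T_in: "M \<in> hecke_group q \<Longrightarrow> T_mat q ** M \<in> hecke_group q"
| T_inv_in: "M \<in> hecke_group q \<Longrightarrow> matrix_inv (T_mat q) ** M \<in> hecke_group q"

definition e1 :: "real^2" where
  "e1 = vector [1, 0]"

text \<open>Lambda_q = G_q (1,0)^T\<close>
definition Lambda_q :: "nat \<Rightarrow> (real^2) set" where
  "Lambda_q q = {M *v e1 | M. M \<in> hecke_group q}"

definition U_mat :: "nat \<Rightarrow> real^2^2" where
  "U_mat q = T_mat q ** S_mat"

text \<open>(x_j^q, y_j^q)^T = U_q^j (1,0)^T\<close>
definition xy_q :: "nat \<Rightarrow> nat \<Rightarrow> real^2" where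
  "xy_q q j = ((\<lambda>v. U_mat q *v v) ^^ j) e1"

definition x_q :: "nat \<Rightarrow> nat \<Rightarrow> real" where
  "x_q q j = xy_q q j $ 1"

definition y_q :: "nat \<Rightarrow> nat \<Rightarrow> real" where
  "y_q q j = xy_q q j $ 2"

definition wedge :: "real^2 \<Rightarrow> real^2 \<Rightarrow> real" where
  "wedge v w = v $ 1 * w $ 2 - w $ 1 * v $ 2"

definition sector :: "real^2 \<Rightarrow> real^2 \<Rightarrow> (real^2) set" where
  "sector u0 u1 = {a *\<^sub>R u0 + b *\<^sub>R u1 | a b. a \<ge> 0 \<and> b \<ge> 0}"

text \<open>One refinement step: each consecutive pair (v,w) is replaced by the q vectors
  x_j v + y_j w, j = 0..q-1; shared endpoints between consecutive blocks are listed once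
  (the first vector of each subsequent block is dropped).\<close>
fun refine :: "nat \<Rightarrow> (real^2) list \<Rightarrow> (real^2) list" where
  "refine q [] = []"
| "refine q [v] = [v]"
| "refine q (v # w # rest) =
     map (\<lambda>j. x_q q j *\<^sub>R v + y_q q j *\<^sub>R w) [0..<q] @ tl (refine q (w # rest))"

definition SB_list :: "nat \<Rightarrow> real^2 \<Rightarrow> real^2 \<Rightarrow> nat \<Rightarrow> (real^2) list" where
  "SB_list q u0 u1 n = (refine q ^^ n) [u0, u1]"

end

theory Submission
  imports Defs
begin

text \<open>
  A pair \<open>(u\<^sub>0, u\<^sub>1)\<close> in \<open>\<Lambda>\<^sub>q\<close> with \<open>u\<^sub>0 \<and> u\<^sub>1 = 1\<close> is the image \<open>(g e\<^sub>1, g e\<^sub>2)\<close> of the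
  standard basis under some \<open>g \<in> G\<^sub>q\<close>, and the refinement commutes with linear maps, so
  everything reduces to the lists grown from \<open>(e\<^sub>1, e\<^sub>2)\<close>. Since \<open>(x\<^sub>j, y\<^sub>j) = U\<^sup>j e\<^sub>1\<close> and
  \<open>U\<^sup>j T e\<^sub>2 = U\<^sup>j\<^sup>+\<^sup>1 e\<^sub>1\<close>, every consecutive pair of \<open>L\<^sub>n\<close> is again of the form
  \<open>(h e\<^sub>1, h e\<^sub>2)\<close> with \<open>h \<in> G\<^sub>q\<close>; this gives membership in \<open>\<Lambda>\<^sub>q\<close> and unimodularity.

  For the converse let \<open>\<T>\<close> be the set of all entries of the lists grown from \<open>(e\<^sub>1, e\<^sub>2)\<close>.
  The map \<open>U\<close> shifts the blocks of \<open>\<T>\<close> by one, and the block falling off the end is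
  \<open>(U\<^sup>q\<^sup>-\<^sup>1 e\<^sub>1, U\<^sup>q e\<^sub>1) = (S e\<^sub>1, S e\<^sub>2)\<close>; hence \<open>U \<T> \<subseteq> \<T> \<union> S \<T>\<close> and likewise \<open>T \<T> \<subseteq> \<T>\<close>.
  As \<open>S\<^sup>2 = U\<^sup>q = -1\<close>, the union of the four rotations \<open>S\<^sup>k \<T>\<close> is \<open>G\<^sub>q\<close>-invariant, so it
  contains \<open>\<Lambda>\<^sub>q = G\<^sub>q e\<^sub>1\<close>. An explicit description of the shapes occurring in \<open>\<T>\<close> (the
  only entries on the axes are \<open>e\<^sub>1, e\<^sub>2\<close>, and those of height one are \<open>(k\<lambda>\<^sub>q, 1)\<close>) then
  yields that \<open>\<T>\<close> is all of \<open>\<Lambda>\<^sub>q\<close> in the closed first quadrant, and that every vector of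
  \<open>\<Lambda>\<^sub>q\<close> at height one is \<open>(k\<lambda>\<^sub>q, 1)\<close> with \<open>k \<in> \<int>\<close>. The latter gives the transitivity
  of \<open>G\<^sub>q\<close> on unimodular pairs used at the start.
\<close>

lemma vec2_eq_iff: "(v::'a^2) = w \<longleftrightarrow> v$1 = w$1 \<and> v$2 = w$2"
  by (simp add: vec_eq_iff forall_2)

definition e2 :: "real^2" where
  "e2 = vector [0, 1]"

lemma e1_components [simp]: "e1$1 = 1" "e1$2 = 0"
  and e2_components [simp]: "e2$1 = 0" "e2$2 = 1"
  by (simp_all add: e1_def e2_def)

lemma wedge_matrix_vector_mult:
  "wedge (M *v v) (M *v w) = det M * wedge v (w::real^2)"
  by (simp add: wedge_def det_2 matrix_vector_mult_def sum_2 algebra_simps)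

lemma matrix_vector_mult_lincomb:
  "(M::real^'n^'m) *v (a *\<^sub>R v + b *\<^sub>R w) = a *\<^sub>R (M *v v) + b *\<^sub>R (M *v w)"
  by (simp add: matrix_vector_right_distrib matrix_vector_mult_scaleR)

lemma matrix_vector_mult_basis: "(M::real^2^2) *v x = x$1 *\<^sub>R (M *v e1) + x$2 *\<^sub>R (M *v e2)"
proof -
  have "x = x$1 *\<^sub>R e1 + x$2 *\<^sub>R e2" by (simp add: vec2_eq_iff)
  then show ?thesis by (metis matrix_vector_mult_lincomb)
qed

lemma matrix_inv_inverse:
  assumes "invertible (A::'a::semiring_1^'n^'n)"
  shows "A ** matrix_inv A = mat 1" "matrix_inv A ** A = mat 1"
  using someI_ex[OF assms[unfolded invertible_def]] by (simp_all add: matrix_inv_def)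

lemma matrix_inv_vector_eqI:
  assumes "invertible (A::'a::comm_semiring_1^'n^'n)" "A *v y = x"
  shows "matrix_inv A *v x = y"
proof -
  have "matrix_inv A *v x = (matrix_inv A ** A) *v y"
    using assms(2) by (simp add: matrix_vector_mul_assoc[symmetric])
  then show ?thesis by (simp add: matrix_inv_inverse(2)[OF assms(1)])
qed

lemma S_mat_act: "S_mat *v v = vector [- v$2, v$1]"
  by (simp add: vec2_eq_iff S_mat_def matrix_vector_mult_def sum_2)

lemma T_mat_act: "T_mat q *v v = vector [v$1 + lambda_q q * v$2, v$2]"
  by (simp add: vec2_eq_iff T_mat_def matrix_vector_mult_def sum_2)

lemma U_mat_act: "U_mat q *v v = vector [lambda_q q * v$1 - v$2, v$1]"
  by (simp add: U_mat_def matrix_vector_mul_assoc[symmetric] S_mat_act T_mat_act)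

lemma xy_q_Suc: "xy_q q (Suc j) = U_mat q *v xy_q q j"
  by (simp add: xy_q_def)

lemma S_mat_S_mat_act: "S_mat *v (S_mat *v x) = - x"
  by (simp add: vec2_eq_iff S_mat_act)

lemma S_mat_uminus_act: "S_mat *v (- x) = - (S_mat *v x)"
  by (simp add: vec2_eq_iff S_mat_act)

lemma U_mat_S_mat_act: "U_mat q *v (S_mat *v x) = - (T_mat q *v x)"
  by (simp add: vec2_eq_iff S_mat_act T_mat_act U_mat_act)

lemma U_mat_uminus_act: "U_mat q *v (- x) = - (U_mat q *v x)"
  by (simp add: vec2_eq_iff U_mat_act)

lemma U_mat_pow_Suc:
  "((*v) (U_mat q) ^^ Suc n) v = v$1 *\<^sub>R xy_q q (Suc n) - v$2 *\<^sub>R xy_q q n"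
proof (induction n)
  case 0
  show ?case by (simp add: vec2_eq_iff U_mat_act xy_q_def)
next
  case (Suc n)
  then show ?case
    by (simp add: xy_q_Suc matrix_vector_mult_diff_distrib matrix_vector_mult_scaleR)
qed

lemma det_S_mat: "det S_mat = 1"
  by (simp add: det_2 S_mat_def)

lemma det_T_mat: "det (T_mat q) = 1"
  by (simp add: det_2 T_mat_def)

lemma invertible_S_mat: "invertible S_mat" and invertible_T_mat: "invertible (T_mat q)"
  by (simp_all add: invertible_det_nz det_S_mat det_T_mat)

subsection \<open>The Hecke group\<close>

lemma hecke_group_mult:
  assumes "M \<in> hecke_group q" "N \<in> hecke_group q"
  shows "M ** N \<in> hecke_group q"
  using assms(1) by induction (simp_all add: assms(2) matrix_mul_assoc[symmetric] hecke_group.intros)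

lemma hecke_group_generators:
  "S_mat \<in> hecke_group q" "matrix_inv S_mat \<in> hecke_group q"
  "T_mat q \<in> hecke_group q" "matrix_inv (T_mat q) \<in> hecke_group q"
  by (metis hecke_group.intros matrix_mul_rid)+

lemma U_mat_in_hecke_group: "U_mat q \<in> hecke_group q"
  unfolding U_mat_def by (intro hecke_group_mult hecke_group_generators)

lemma hecke_group_inverse_step:
  assumes "\<exists>N\<in>hecke_group q. N ** M = mat 1 \<and> M ** N = mat 1"
    and "B \<in> hecke_group q" "A ** B = mat 1" "B ** A = mat 1"
  shows "\<exists>N\<in>hecke_group q. N ** (A ** M) = mat 1 \<and> (A ** M) ** N = mat 1"
proof -
  obtain N where N: "N \<in> hecke_group q" "N ** M = mat 1" "M ** N = mat 1"
    using assms(1) by blast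
  have "(N ** B) ** (A ** M) = mat 1"
    by (metis N(2) assms(4) matrix_mul_assoc matrix_mul_lid)
  moreover have "(A ** M) ** (N ** B) = mat 1"
    by (metis N(3) assms(3) matrix_mul_assoc matrix_mul_lid)
  ultimately show ?thesis using N(1) assms(2) hecke_group_mult by blast
qed

lemma hecke_group_inverse:
  assumes "M \<in> hecke_group q"
  shows "\<exists>N\<in>hecke_group q. N ** M = mat 1 \<and> M ** N = mat 1"
  using assms
proof induction
  case id_in
  show ?case using hecke_group.id_in by fastforce
qed (use hecke_group_inverse_step hecke_group_generators matrix_inv_inverse invertible_S_mat
    invertible_T_mat in blast)+

lemma det_hecke_group: "M \<in> hecke_group q \<Longrightarrow> det M = 1"
proof (induction rule: hecke_group.induct)
  case (S_inv_in M)
  have "det (matrix_inv S_mat) * det S_mat = 1"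
    by (metis det_I det_mul matrix_inv_inverse(2)[OF invertible_S_mat])
  then show ?case using S_inv_in by (simp add: det_mul det_S_mat)
next
  case (T_inv_in M)
  have "det (matrix_inv (T_mat q)) * det (T_mat q) = 1"
    by (metis det_I det_mul matrix_inv_inverse(2)[OF invertible_T_mat])
  then show ?case using T_inv_in by (simp add: det_mul det_T_mat)
qed (simp_all add: det_mul det_S_mat det_T_mat)

lemma e1_in_Lambda_q: "e1 \<in> Lambda_q q"
  unfolding Lambda_q_def using hecke_group.id_in by force

lemma hecke_group_act_Lambda_q:
  "M \<in> hecke_group q \<Longrightarrow> v \<in> Lambda_q q \<Longrightarrow> M *v v \<in> Lambda_q q"
  unfolding Lambda_q_def by (auto simp: matrix_vector_mul_assoc intro: hecke_group_mult)

lemma hecke_group_translation: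
  "\<exists>M\<in>hecke_group q. M *v e1 = e1 \<and> M *v e2 = vector [of_int k * lambda_q q, 1]"
proof (induction k rule: int_induct[of _ 0])
  case base
  show ?case using hecke_group.id_in by (force simp: vec2_eq_iff)
next
  case (step1 k)
  then obtain M where "M \<in> hecke_group q" "M *v e1 = e1" "M *v e2 = vector [of_int k * lambda_q q, 1]"
    by blast
  then show ?case
    by (intro bexI[of _ "T_mat q ** M"])
      (auto simp: matrix_vector_mul_assoc[symmetric] T_mat_act vec2_eq_iff algebra_simps
        intro: hecke_group.T_in)
next
  case (step2 k)
  then obtain M where M: "M \<in> hecke_group q" "M *v e1 = e1"
    "M *v e2 = vector [of_int k * lambda_q q, 1]"
    by blast
  have "matrix_inv (T_mat q) *v vector [of_int k * lambda_q q, 1]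
      = vector [of_int (k - 1) * lambda_q q, 1]"
    "matrix_inv (T_mat q) *v e1 = e1"
    by (intro matrix_inv_vector_eqI invertible_T_mat; simp add: T_mat_act vec2_eq_iff algebra_simps)+
  then show ?case using M
    by (intro bexI[of _ "matrix_inv (T_mat q) ** M"])
      (auto simp: matrix_vector_mul_assoc[symmetric] intro: hecke_group.T_inv_in)
qed

definition hecke_frame :: "nat \<Rightarrow> real^2 \<Rightarrow> real^2 \<Rightarrow> bool" where
  "hecke_frame q v w \<longleftrightarrow> (\<exists>M\<in>hecke_group q. M *v e1 = v \<and> M *v e2 = w)"

lemma hecke_frame_Lambda_q:
  assumes "hecke_frame q v w"
  shows "v \<in> Lambda_q q" "w \<in> Lambda_q q" "wedge v w = 1"
proof -
  obtain M where M: "M \<in> hecke_group q" "M *v e1 = v" "M *v e2 = w"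
    using assms unfolding hecke_frame_def by blast
  have "e2 = S_mat *v e1" by (simp add: vec2_eq_iff S_mat_act)
  then have "e2 \<in> Lambda_q q"
    using hecke_group_act_Lambda_q hecke_group_generators e1_in_Lambda_q by metis
  then show "v \<in> Lambda_q q" "w \<in> Lambda_q q"
    using M e1_in_Lambda_q hecke_group_act_Lambda_q by blast+
  show "wedge v w = 1"
    using M wedge_matrix_vector_mult[of M e1 e2] by (simp add: det_hecke_group wedge_def)
qed

lemma hecke_frame_mult:
  "M \<in> hecke_group q \<Longrightarrow> hecke_frame q v w \<Longrightarrow> hecke_frame q (M *v v) (M *v w)"
  unfolding hecke_frame_def by (auto simp: matrix_vector_mul_assoc intro: hecke_group_mult)

lemma hecke_frame_xy_q: "hecke_frame q (xy_q q j) (xy_q q (Suc j))"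
proof (induction j)
  case 0
  have "T_mat q *v e1 = xy_q q 0" "T_mat q *v e2 = xy_q q 1"
    by (simp_all add: xy_q_def vec2_eq_iff T_mat_act U_mat_act)
  then show ?case using hecke_group_generators(3) by (auto simp: hecke_frame_def)
next
  case (Suc j)
  then show ?case using hecke_frame_mult[OF U_mat_in_hecke_group] by (simp add: xy_q_Suc)
qed

subsection \<open>Consecutive pairs of a list\<close>

definition adj_pairs :: "'a list \<Rightarrow> ('a \<times> 'a) set" where
  "adj_pairs xs = set (zip xs (tl xs))"

lemma adj_pairs_simps [simp]:
  "adj_pairs [] = {}" "adj_pairs [x] = {}"
  "adj_pairs (x # y # ys) = insert (x, y) (adj_pairs (y # ys))"
  by (simp_all add: adj_pairs_def)

lemma adj_pairs_conv_nth: "adj_pairs xs = {(xs ! i, xs ! Suc i) | i. Suc i < length xs}"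
  by (auto simp: adj_pairs_def set_zip nth_tl)

lemma adj_pairs_subset: "(v, w) \<in> adj_pairs xs \<Longrightarrow> v \<in> set xs \<and> w \<in> set xs"
  by (auto simp: adj_pairs_conv_nth)

lemma adj_pairs_append:
  "adj_pairs (xs @ y # ys) = adj_pairs (xs @ [y]) \<union> adj_pairs (y # ys)"
  by (induction xs rule: induct_list012) auto

lemma set_eq_adj_pairs: "2 \<le> length xs \<Longrightarrow> set xs = (\<Union>(v, w)\<in>adj_pairs xs. {v, w})"
proof (induction xs rule: induct_list012)
  case (3 x y zs)
  show ?case
  proof (cases zs)
    case (Cons z zs')
    then have "set (y # zs) = (\<Union>(v, w)\<in>adj_pairs (y # zs). {v, w})" using 3 by simp
    then show ?thesis by auto
  qed simp
qed simp_all

lemma adj_pairs_map_upt: "adj_pairs (map f [0..<n]) = {(f j, f (Suc j)) | j. Suc j < n}"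
proof -
  have nth: "\<And>i. Suc i < n \<Longrightarrow> map f [0..<n] ! i = f i \<and> map f [0..<n] ! Suc i = f (Suc i)"
    by (simp del: upt_Suc)
  then show ?thesis unfolding adj_pairs_conv_nth by (auto simp del: upt_Suc) (metis nth)
qed

subsection \<open>The refinement step\<close>

definition mediant :: "nat \<Rightarrow> real^2 \<Rightarrow> real^2 \<Rightarrow> nat \<Rightarrow> real^2" where
  "mediant q v w j = x_q q j *\<^sub>R v + y_q q j *\<^sub>R w"

definition mediants :: "nat \<Rightarrow> real^2 \<Rightarrow> real^2 \<Rightarrow> (real^2) list" where
  "mediants q v w = map (mediant q v w) [0..<q]"

lemma refine_Cons_Cons:
  "refine q (v # w # rest) = mediants q v w @ tl (refine q (w # rest))"
  by (simp add: mediants_def mediant_def[abs_def])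

declare refine.simps(3) [simp del]

lemma set_mediants: "set (mediants q v w) = mediant q v w ` {..<q}"
  by (auto simp: mediants_def)

lemma adj_pairs_mediants:
  "adj_pairs (mediants q v w) = {(mediant q v w j, mediant q v w (Suc j)) | j. Suc j < q}"
  by (simp add: mediants_def adj_pairs_map_upt)

lemma matrix_vector_mult_mediant:
  "M *v mediant q v w j = mediant q (M *v v) (M *v w) j"
  by (simp add: mediant_def matrix_vector_mult_lincomb)

lemma mediant_e1_e2: "mediant q e1 e2 j = xy_q q j"
  by (simp add: vec2_eq_iff mediant_def x_q_def y_q_def)

lemma hecke_frame_mediant:
  assumes "hecke_frame q v w"
  shows "hecke_frame q (mediant q v w j) (mediant q v w (Suc j))"
proof -
  obtain M where M: "M \<in> hecke_group q" "M *v e1 = v" "M *v e2 = w"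
    using assms unfolding hecke_frame_def by blast
  have "mediant q v w i = M *v xy_q q i" for i
    using matrix_vector_mult_mediant[of M q e1 e2 i] M by (simp add: mediant_e1_e2)
  then show ?thesis using hecke_frame_mult[OF M(1) hecke_frame_xy_q] by simp
qed

lemma refine_map_linear:
  assumes "linear f"
  shows "refine q (map f xs) = map f (refine q xs)"
proof (induction q xs rule: refine.induct)
  case (3 q v w rest)
  have "f (mediant q v w j) = mediant q (f v) (f w) j" for j
    using assms by (simp add: mediant_def linear_add linear_scale)
  then show ?case using 3 by (simp add: refine_Cons_Cons mediants_def map_tl)
qed simp_all

lemma SB_list_Suc: "SB_list q a b (Suc n) = refine q (SB_list q a b n)"
  by (simp add: SB_list_def)

lemma SB_list_linear_image:
  "linear f \<Longrightarrow> SB_list q (f a) (f b) n = map f (SB_list q a b n)"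
proof (induction n)
  case (Suc n)
  then show ?case by (simp add: SB_list_def refine_map_linear)
qed (simp add: SB_list_def)

definition sb_tree :: "nat \<Rightarrow> real^2 \<Rightarrow> real^2 \<Rightarrow> (real^2) set" where
  "sb_tree q a b = (\<Union>n. set (SB_list q a b n))"

lemma sb_tree_linear_image: "linear f \<Longrightarrow> sb_tree q (f a) (f b) = f ` sb_tree q a b"
  by (auto simp: sb_tree_def SB_list_linear_image)

lemma sb_tree_ends: "a \<in> sb_tree q a b" "b \<in> sb_tree q a b"
  by (auto simp: sb_tree_def SB_list_def intro!: exI[of _ 0])

subsection \<open>The coefficients \<open>x\<^sub>j\<close> and \<open>y\<^sub>j\<close>\<close>

lemma sin_le_sin_between:
  fixes t x :: real
  assumes "0 \<le> t" "t \<le> x" "x \<le> pi - t"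
  shows "sin t \<le> sin x"
proof (cases "x \<le> pi / 2")
  case True
  then show ?thesis using assms by (intro sin_monotone_2pi_le) auto
next
  case False
  have "sin t \<le> sin (pi - x)" using assms False by (intro sin_monotone_2pi_le) auto
  then show ?thesis by simp
qed

lemma sin_less_sin_between:
  fixes t x :: real
  assumes "0 \<le> t" "t < x" "x < pi - t"
  shows "sin t < sin x"
proof (cases "x \<le> pi / 2")
  case True
  then show ?thesis using assms by (intro sin_monotone_2pi) auto
next
  case False
  have "sin t < sin (pi - x)" using assms False by (intro sin_monotone_2pi) auto
  then show ?thesis by simp
qed

lemma one_le_add_mult:
  fixes s a t :: real
  assumes "1 \<le> s" "1 \<le> a" "0 \<le> t"
  shows "1 \<le> t + s * a"
proof -
  have "s * 1 \<le> s * a" using assms by (intro mult_left_mono) simp_all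
  then show ?thesis using assms by linarith
qed

lemma one_less_add_mult:
  fixes s a t :: real
  assumes "1 < s" "1 \<le> a" "0 \<le> t"
  shows "1 < t + s * a"
proof -
  have "s * 1 \<le> s * a" using assms by (intro mult_left_mono) simp_all
  then show ?thesis using assms by linarith
qed

definition sin_quot :: "nat \<Rightarrow> nat \<Rightarrow> real" where
  "sin_quot q j = sin (real j * (pi / real q)) / sin (pi / real q)"

locale hecke =
  fixes q :: nat
  assumes three_le_q: "3 \<le> q"
begin

lemma sin_pi_div_q_pos: "0 < sin (pi / real q)"
  using three_le_q by (intro sin_gt_zero) (auto simp: field_simps)

lemma sin_quot_0 [simp]: "sin_quot q 0 = 0"
  by (simp add: sin_quot_def)

lemma sin_quot_1 [simp]: "sin_quot q (Suc 0) = 1"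
  using sin_pi_div_q_pos by (simp add: sin_quot_def)

lemma sin_quot_Suc_Suc:
  "sin_quot q (Suc (Suc j)) = lambda_q q * sin_quot q (Suc j) - sin_quot q j"
proof -
  define t where "t = pi / real q"
  define x where "x = real (Suc j) * t"
  have "real (Suc (Suc j)) * t = x + t" "real j * t = x - t"
    by (simp_all add: x_def algebra_simps)
  moreover have "sin (x + t) = 2 * cos t * sin x - sin (x - t)"
    by (simp add: sin_add sin_diff)
  ultimately show ?thesis
    by (simp add: sin_quot_def lambda_q_def diff_divide_distrib x_def flip: t_def)
qed

lemma sin_quot_2: "sin_quot q 2 = lambda_q q"
  using sin_quot_Suc_Suc[of 0] by (simp add: numeral_2_eq_2)

lemma sin_quot_q: "sin_quot q q = 0"
  using three_le_q by (simp add: sin_quot_def)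

lemma sin_quot_q_minus_1: "sin_quot q (q - 1) = 1"
proof -
  have "real (q - 1) * (pi / real q) = pi - pi / real q"
    using three_le_q by (simp add: of_nat_diff field_simps)
  then show ?thesis using sin_pi_div_q_pos by (simp add: sin_quot_def)
qed

lemma sin_quot_Suc_q: "sin_quot q (Suc q) = -1"
proof -
  have "real (Suc q) * (pi / real q) = pi / real q + pi"
    using three_le_q by (simp add: field_simps)
  then show ?thesis using sin_pi_div_q_pos by (simp add: sin_quot_def)
qed

lemma sin_quot_q_minus_2: "sin_quot q (q - 2) = lambda_q q"
proof -
  have "q = Suc (Suc (q - 2))" "Suc (q - 2) = q - 1"
    using three_le_q by simp_all
  then have "sin_quot q q = lambda_q q * sin_quot q (q - 1) - sin_quot q (q - 2)"
    by (metis sin_quot_Suc_Suc)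
  then show ?thesis using sin_quot_q sin_quot_q_minus_1 by simp
qed

lemma sin_quot_nonneg: "j \<le> q \<Longrightarrow> 0 \<le> sin_quot q j"
  using three_le_q sin_pi_div_q_pos
  by (auto simp: sin_quot_def field_simps intro!: divide_nonneg_pos sin_ge_zero)

lemma one_le_sin_quot:
  assumes "1 \<le> j" "j \<le> q - 1"
  shows "1 \<le> sin_quot q j"
proof -
  define t where "t = pi / real q"
  have "0 < t" using three_le_q by (simp add: t_def)
  have "pi - t = real (q - 1) * t"
    using three_le_q by (simp add: t_def of_nat_diff field_simps)
  moreover have "real j * t \<le> real (q - 1) * t" "1 * t \<le> real j * t"
    using assms \<open>0 < t\<close> by (intro mult_right_mono; simp)+
  ultimately have "sin t \<le> sin (real j * t)"
    using \<open>0 < t\<close> by (intro sin_le_sin_between) auto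
  then show ?thesis using sin_pi_div_q_pos by (simp add: sin_quot_def flip: t_def)
qed

lemma one_less_sin_quot:
  assumes "2 \<le> j" "j \<le> q - 2"
  shows "1 < sin_quot q j"
proof -
  define t where "t = pi / real q"
  have "0 < t" using three_le_q by (simp add: t_def)
  have "pi - t = real (q - 1) * t"
    using three_le_q by (simp add: t_def of_nat_diff field_simps)
  moreover have "real j * t < real (q - 1) * t" "1 * t < real j * t"
    using assms three_le_q \<open>0 < t\<close> by (intro mult_strict_right_mono; simp)+
  ultimately have "sin t < sin (real j * t)"
    using \<open>0 < t\<close> by (intro sin_less_sin_between) auto
  then show ?thesis using sin_pi_div_q_pos by (simp add: sin_quot_def flip: t_def)
qed

lemma one_le_sin_quot_Suc_add:
  assumes "i < q"
  shows "1 \<le> sin_quot q (Suc i) + sin_quot q i"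
proof (cases "i = 0")
  case False
  then have "1 \<le> sin_quot q i" using assms by (intro one_le_sin_quot) auto
  moreover have "0 \<le> sin_quot q (Suc i)" using assms by (intro sin_quot_nonneg) simp
  ultimately show ?thesis by simp
qed simp

lemma one_le_lambda_q: "1 \<le> lambda_q q"
proof -
  have "cos (pi / 3) \<le> cos (pi / real q)"
    using three_le_q by (intro cos_monotone_0_pi_le) (auto simp: field_simps)
  then show ?thesis by (simp add: lambda_q_def cos_60)
qed

lemma one_le_of_nat_mult_lambda_q: "1 \<le> k \<Longrightarrow> 1 \<le> real k * lambda_q q"
  using one_le_lambda_q mult_mono[of 1 "real k" 1 "lambda_q q"] by simp

lemma xy_q_eq: "xy_q q j = vector [sin_quot q (Suc j), sin_quot q j]"
  by (induction j) (simp_all add: xy_q_def vec2_eq_iff U_mat_act sin_quot_Suc_Suc)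

lemma x_q_eq: "x_q q j = sin_quot q (Suc j)" and y_q_eq: "y_q q j = sin_quot q j"
  by (simp_all add: x_q_def y_q_def xy_q_eq)

subsection \<open>Refinement for \<open>q \<ge> 3\<close>\<close>

lemma mediant_0 [simp]: "mediant q v w 0 = v"
  by (simp add: mediant_def x_q_eq y_q_eq)

lemma mediant_last: "mediant q v w (q - 1) = w"
proof -
  have "Suc (q - 1) = q" using three_le_q by simp
  then show ?thesis
    using sin_quot_q sin_quot_q_minus_1 by (simp add: mediant_def x_q_eq y_q_eq)
qed

lemma mediant_component:
  "mediant q v w j $ i = sin_quot q (Suc j) * v $ i + sin_quot q j * w $ i"
  by (simp add: mediant_def x_q_eq y_q_eq)

lemma mediant_1: "mediant q v w 1 = vector [lambda_q q * v$1 + w$1, lambda_q q * v$2 + w$2]"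
  using sin_quot_2 by (simp add: vec2_eq_iff mediant_component numeral_2_eq_2)

lemma mediant_q_minus_2:
  "mediant q v w (q - 2) = vector [v$1 + lambda_q q * w$1, v$2 + lambda_q q * w$2]"
proof -
  have "Suc (q - 2) = q - 1" using three_le_q by simp
  then show ?thesis
    using sin_quot_q_minus_1 sin_quot_q_minus_2 by (simp add: vec2_eq_iff mediant_component)
qed

lemma mediant_row_components:
  "mediant q e1 (vector [a, 1]) j = vector [sin_quot q (Suc j) + sin_quot q j * a, sin_quot q j]"
  by (simp add: vec2_eq_iff mediant_component)

lemma mediant_column_components:
  "mediant q (vector [1, a]) e2 j = vector [sin_quot q (Suc j), sin_quot q (Suc j) * a + sin_quot q j]"
  by (simp add: vec2_eq_iff mediant_component)

lemma length_mediants: "length (mediants q v w) = q"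
  by (simp add: mediants_def)

lemma mediants_eq_butlast_snoc: "mediants q v w = butlast (mediants q v w) @ [w]"
proof -
  have "mediants q v w \<noteq> []" "last (mediants q v w) = w"
    using three_le_q mediant_last[of v w] by (simp_all add: mediants_def last_map)
  then show ?thesis by (metis append_butlast_last_id)
qed

lemma refine_Cons: "\<exists>ys. refine q (w # rest) = w # ys"
proof (cases rest)
  case (Cons x r)
  have "mediants q w x = w # tl (mediants q w x)"
    using three_le_q by (simp add: mediants_def upt_conv_Cons)
  then show ?thesis using Cons by (metis append_Cons refine_Cons_Cons)
qed simp

lemma refine_Cons_Cons':
  "refine q (v # w # rest) = butlast (mediants q v w) @ refine q (w # rest)"
proof -
  obtain ys where ys: "refine q (w # rest) = w # ys" using refine_Cons by blast
  have "refine q (v # w # rest) = (butlast (mediants q v w) @ [w]) @ ys"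
    using ys by (simp add: refine_Cons_Cons flip: mediants_eq_butlast_snoc)
  then show ?thesis using ys by simp
qed

lemma length_refine: "2 \<le> length xs \<Longrightarrow> 2 \<le> length (refine q xs)"
  using three_le_q
  by (induction xs rule: induct_list012) (auto simp: refine_Cons_Cons length_mediants)

lemma length_SB_list: "2 \<le> length (SB_list q a b n)"
  by (induction n) (simp_all add: SB_list_def length_refine)

lemma adj_pairs_refine:
  "2 \<le> length xs \<Longrightarrow> adj_pairs (refine q xs) = (\<Union>(v, w)\<in>adj_pairs xs. adj_pairs (mediants q v w))"
proof (induction xs rule: induct_list012)
  case (3 v w rest)
  show ?case
  proof (cases rest)
    case Nil
    then show ?thesis by (simp add: refine_Cons_Cons)
  next
    case (Cons x r)
    obtain ys where ys: "refine q (w # rest) = w # ys" using refine_Cons by blast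
    have "adj_pairs (refine q (v # w # rest))
        = adj_pairs (butlast (mediants q v w) @ [w]) \<union> adj_pairs (refine q (w # rest))"
      unfolding refine_Cons_Cons' ys by (rule adj_pairs_append)
    also have "\<dots> = adj_pairs (mediants q v w) \<union> adj_pairs (refine q (w # rest))"
      by (simp flip: mediants_eq_butlast_snoc)
    also have "adj_pairs (refine q (w # rest)) = (\<Union>(v, w)\<in>adj_pairs (w # rest). adj_pairs (mediants q v w))"
      using 3 Cons by simp
    finally show ?thesis by simp
  qed
qed simp_all

lemma set_refine:
  assumes "2 \<le> length xs"
  shows "set (refine q xs) = (\<Union>(v, w)\<in>adj_pairs xs. set (mediants q v w))"
proof -
  have "2 \<le> length (mediants q v w)" for v w using three_le_q by (simp add: length_mediants)
  then show ?thesis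
    using assms by (simp add: set_eq_adj_pairs length_refine adj_pairs_refine) blast
qed

lemma adj_pairs_refineE:
  assumes "(v, w) \<in> adj_pairs (refine q xs)" "2 \<le> length xs"
  obtains a b j where "(a, b) \<in> adj_pairs xs" "Suc j < q"
    "v = mediant q a b j" "w = mediant q a b (Suc j)"
proof -
  obtain a b where "(a, b) \<in> adj_pairs xs" "(v, w) \<in> adj_pairs (mediants q a b)"
    using assms adj_pairs_refine by blast
  then show ?thesis using that unfolding adj_pairs_mediants by blast
qed

lemma set_refineE:
  assumes "x \<in> set (refine q xs)" "2 \<le> length xs"
  obtains a b j where "(a, b) \<in> adj_pairs xs" "j < q" "x = mediant q a b j"
proof -
  obtain a b where "(a, b) \<in> adj_pairs xs" "x \<in> set (mediants q a b)"
    using assms set_refine by blast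
  then show ?thesis using that unfolding set_mediants by blast
qed

lemma set_refine_pow:
  "2 \<le> length xs \<Longrightarrow>
    set ((refine q ^^ n) xs) = (\<Union>(v, w)\<in>adj_pairs xs. set ((refine q ^^ n) [v, w]))"
proof (induction n arbitrary: xs)
  case 0
  then show ?case by (simp add: set_eq_adj_pairs)
next
  case (Suc n)
  have len: "2 \<le> length (mediants q v w)" for v w using three_le_q by (simp add: length_mediants)
  have "set ((refine q ^^ Suc n) xs) = set ((refine q ^^ n) (refine q xs))"
    by (simp add: funpow_Suc_right del: funpow.simps)
  also have "\<dots> = (\<Union>(v, w)\<in>adj_pairs (refine q xs). set ((refine q ^^ n) [v, w]))"
    using Suc.IH length_refine[OF Suc.prems] by blast
  also have "\<dots> = (\<Union>(a, b)\<in>adj_pairs xs. \<Union>(v, w)\<in>adj_pairs (mediants q a b).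
      set ((refine q ^^ n) [v, w]))"
    unfolding adj_pairs_refine[OF Suc.prems] by blast
  also have "\<dots> = (\<Union>(a, b)\<in>adj_pairs xs. set ((refine q ^^ n) (mediants q a b)))"
    using Suc.IH[OF len] by simp
  also have "\<dots> = (\<Union>(a, b)\<in>adj_pairs xs. set ((refine q ^^ Suc n) [a, b]))"
    by (simp add: funpow_Suc_right refine_Cons_Cons del: funpow.simps)
  finally show ?case .
qed

lemma set_SB_list_Suc:
  "set (SB_list q a b (Suc n)) = (\<Union>j\<in>{j. Suc j < q}.
      set (SB_list q (mediant q a b j) (mediant q a b (Suc j)) n))"
proof -
  have "set (SB_list q a b (Suc n)) = set ((refine q ^^ n) (mediants q a b))"
    by (simp add: SB_list_def funpow_Suc_right refine_Cons_Cons del: funpow.simps)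
  also have "\<dots> = (\<Union>(v, w)\<in>adj_pairs (mediants q a b). set ((refine q ^^ n) [v, w]))"
    using three_le_q by (intro set_refine_pow) (simp add: length_mediants)
  finally show ?thesis unfolding adj_pairs_mediants SB_list_def by blast
qed

lemma sb_tree_unfold:
  "sb_tree q a b = (\<Union>j\<in>{j. Suc j < q}. sb_tree q (mediant q a b j) (mediant q a b (Suc j)))"
    (is "_ = ?R")
proof
  show "?R \<subseteq> sb_tree q a b"
  proof
    fix x assume "x \<in> ?R"
    then obtain j n where "Suc j < q" "x \<in> set (SB_list q (mediant q a b j) (mediant q a b (Suc j)) n)"
      by (auto simp: sb_tree_def)
    then have "x \<in> set (SB_list q a b (Suc n))" unfolding set_SB_list_Suc by blast
    then show "x \<in> sb_tree q a b" by (auto simp: sb_tree_def)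
  qed
  show "sb_tree q a b \<subseteq> ?R"
  proof
    fix x assume "x \<in> sb_tree q a b"
    then obtain n where n: "x \<in> set (SB_list q a b n)" by (auto simp: sb_tree_def)
    show "x \<in> ?R"
    proof (cases n)
      case 0
      then have "x = a \<or> x = b" using n by (simp add: SB_list_def)
      moreover have "a \<in> sb_tree q (mediant q a b 0) (mediant q a b (Suc 0))"
        using sb_tree_ends by simp
      moreover have "Suc (q - 2) = q - 1" using three_le_q by simp
      then have "b \<in> sb_tree q (mediant q a b (q - 2)) (mediant q a b (Suc (q - 2)))"
        using sb_tree_ends mediant_last by simp
      moreover have "Suc 0 < q" "Suc (q - 2) < q" using three_le_q by auto
      ultimately show ?thesis by blast
    next
      case (Suc m)
      then obtain j where "Suc j < q" "x \<in> set (SB_list q (mediant q a b j) (mediant q a b (Suc j)) m)"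
        using n set_SB_list_Suc by blast
      then show ?thesis unfolding sb_tree_def by blast
    qed
  qed
qed

lemma sb_tree_mediant_subset:
  "Suc j < q \<Longrightarrow> sb_tree q (mediant q a b j) (mediant q a b (Suc j)) \<subseteq> sb_tree q a b"
  by (subst (2) sb_tree_unfold) (rule UN_upper, simp)

subsection \<open>The shape of the standard tree\<close>

definition tree_point :: "real^2 \<Rightarrow> bool" where
  "tree_point v \<longleftrightarrow> v = e1 \<or> v = e2
     \<or> (\<exists>k::nat. 1 \<le> k \<and> v = vector [real k * lambda_q q, 1])
     \<or> (\<exists>k::nat. 1 \<le> k \<and> v = vector [1, real k * lambda_q q])
     \<or> (1 < v$1 \<and> 1 < v$2)"

definition tree_edge :: "real^2 \<Rightarrow> real^2 \<Rightarrow> bool" where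
  "tree_edge v w \<longleftrightarrow> (v = e1 \<and> w = e2)
     \<or> (v = e1 \<and> (\<exists>k::nat. 1 \<le> k \<and> w = vector [real k * lambda_q q, 1]))
     \<or> (w = e2 \<and> (\<exists>k::nat. 1 \<le> k \<and> v = vector [1, real k * lambda_q q]))
     \<or> (1 \<le> v$1 \<and> 1 \<le> v$2 \<and> 1 \<le> w$1 \<and> 1 \<le> w$2)"

lemma tree_point_row: "1 \<le> k \<Longrightarrow> tree_point (vector [real k * lambda_q q, 1])"
  and tree_point_column: "1 \<le> k \<Longrightarrow> tree_point (vector [1, real k * lambda_q q])"
  and tree_point_big: "1 < v$1 \<Longrightarrow> 1 < v$2 \<Longrightarrow> tree_point v"
  unfolding tree_point_def by blast+

lemma tree_edge_row: "1 \<le> k \<Longrightarrow> tree_edge e1 (vector [real k * lambda_q q, 1])"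
  and tree_edge_column: "1 \<le> k \<Longrightarrow> tree_edge (vector [1, real k * lambda_q q]) e2"
  and tree_edge_big: "1 \<le> v$1 \<Longrightarrow> 1 \<le> v$2 \<Longrightarrow> 1 \<le> w$1 \<Longrightarrow> 1 \<le> w$2 \<Longrightarrow> tree_edge v w"
  unfolding tree_edge_def by blast+

lemma tree_point_cases:
  assumes "tree_point v"
  obtains "v = e1" | "v = e2"
    | k where "1 \<le> k" "v = vector [real k * lambda_q q, 1]"
    | k where "1 \<le> k" "v = vector [1, real k * lambda_q q]"
    | "1 < v$1" "1 < v$2"
  using assms that unfolding tree_point_def by fast

lemma tree_edge_cases:
  assumes "tree_edge v w"
  obtains "v = e1" "w = e2"
    | k where "v = e1" "1 \<le> k" "w = vector [real k * lambda_q q, 1]"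
    | k where "w = e2" "1 \<le> k" "v = vector [1, real k * lambda_q q]"
    | "1 \<le> v$1" "1 \<le> v$2" "1 \<le> w$1" "1 \<le> w$2"
  using assms that unfolding tree_edge_def by fast

lemma tree_point_mediant_e1_e2:
  assumes "1 \<le> j" "j \<le> q - 2"
  shows "tree_point (mediant q e1 e2 j)"
proof -
  consider "j = 1" | "j = q - 2" | "2 \<le> j" "Suc j \<le> q - 2" using assms by linarith
  then show ?thesis
  proof cases
    case 1
    then show ?thesis using mediant_1 tree_point_row[of 1] by simp
  next
    case 2
    then show ?thesis using mediant_q_minus_2 tree_point_column[of 1] by simp
  next
    case 3
    then show ?thesis using one_less_sin_quot[of j] one_less_sin_quot[of "Suc j"]
      by (intro tree_point_big) (simp_all add: mediant_component)
  qed
qed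

lemma tree_point_mediant_row:
  assumes "1 \<le> k" "1 \<le> j" "j \<le> q - 2"
  shows "tree_point (mediant q e1 (vector [real k * lambda_q q, 1]) j)"
proof (cases "j = 1")
  case True
  then have "mediant q e1 (vector [real k * lambda_q q, 1]) j = vector [real (Suc k) * lambda_q q, 1]"
    using mediant_1 by (simp add: vec2_eq_iff distrib_right)
  then show ?thesis using tree_point_row[of "Suc k"] by simp
next
  case False
  have "1 < sin_quot q j" using False assms by (intro one_less_sin_quot) auto
  then have "1 < sin_quot q (Suc j) + sin_quot q j * (real k * lambda_q q)"
    using assms one_le_of_nat_mult_lambda_q by (intro one_less_add_mult sin_quot_nonneg) auto
  then show ?thesis using \<open>1 < sin_quot q j\<close>
    by (intro tree_point_big) (simp_all only: mediant_row_components vector_2)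
qed

lemma tree_point_mediant_column:
  assumes "1 \<le> k" "1 \<le> j" "j \<le> q - 2"
  shows "tree_point (mediant q (vector [1, real k * lambda_q q]) e2 j)"
proof (cases "j = q - 2")
  case True
  then have "mediant q (vector [1, real k * lambda_q q]) e2 j = vector [1, real (Suc k) * lambda_q q]"
    using mediant_q_minus_2 by (simp add: vec2_eq_iff distrib_right)
  then show ?thesis using tree_point_column[of "Suc k"] by simp
next
  case False
  have "1 < sin_quot q (Suc j)" using False assms by (intro one_less_sin_quot) auto
  then have "1 < sin_quot q j + sin_quot q (Suc j) * (real k * lambda_q q)"
    using assms one_le_of_nat_mult_lambda_q by (intro one_less_add_mult sin_quot_nonneg) auto
  then show ?thesis using \<open>1 < sin_quot q (Suc j)\<close>
    by (intro tree_point_big) (simp_all only: mediant_column_components vector_2 add.commute)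
qed

lemma tree_point_mediant_interior:
  assumes "1 \<le> v$1" "1 \<le> v$2" "1 \<le> w$1" "1 \<le> w$2" "1 \<le> j" "j \<le> q - 2"
  shows "tree_point (mediant q v w j)"
proof -
  have s: "1 \<le> sin_quot q j" "1 \<le> sin_quot q (Suc j)"
    using assms(5,6) by (intro one_le_sin_quot; simp)+
  have "1 < mediant q v w j $ i" if "1 \<le> v$i" "1 \<le> w$i" for i
    using s that mult_mono[of 1 "sin_quot q (Suc j)" 1 "v$i"] mult_mono[of 1 "sin_quot q j" 1 "w$i"]
    by (simp add: mediant_component)
  then show ?thesis using assms by (intro tree_point_big) simp_all
qed

lemma tree_point_mediant:
  assumes "tree_edge v w" "1 \<le> j" "j \<le> q - 2"
  shows "tree_point (mediant q v w j)"
  using assms(1)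
  by (cases rule: tree_edge_cases)
    (use assms(2,3) tree_point_mediant_e1_e2 tree_point_mediant_row tree_point_mediant_column
      tree_point_mediant_interior in simp_all)

lemma tree_edge_mediant_e1_e2:
  assumes "Suc j < q"
  shows "tree_edge (mediant q e1 e2 j) (mediant q e1 e2 (Suc j))"
proof -
  have last: "Suc (q - 2) = q - 1" using three_le_q by simp
  consider "j = 0" | "j = q - 2" | "1 \<le> j" "Suc j \<le> q - 2" using assms by linarith
  then show ?thesis
  proof cases
    case 1
    then show ?thesis using mediant_1 tree_edge_row[of 1] by simp
  next
    case 2
    then show ?thesis using mediant_q_minus_2 mediant_last tree_edge_column[of 1] last by simp
  next
    case 3
    then show ?thesis
      using one_le_sin_quot[of j] one_le_sin_quot[of "Suc j"] one_le_sin_quot[of "Suc (Suc j)"]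
      by (intro tree_edge_big) (simp_all add: mediant_component)
  qed
qed

lemma tree_edge_mediant_row:
  assumes "1 \<le> k" "Suc j < q"
  shows "tree_edge (mediant q e1 (vector [real k * lambda_q q, 1]) j)
    (mediant q e1 (vector [real k * lambda_q q, 1]) (Suc j))"
    (is "tree_edge (?c j) (?c (Suc j))")
proof (cases "j = 0")
  case True
  have "?c (Suc 0) = vector [real (Suc k) * lambda_q q, 1]"
    using mediant_1 by (simp add: vec2_eq_iff distrib_right)
  then show ?thesis using True tree_edge_row[of "Suc k"] by simp
next
  case False
  have "1 \<le> ?c i $ 1 \<and> 1 \<le> ?c i $ 2" if "1 \<le> i" "i \<le> q - 1" for i
  proof -
    have "1 \<le> sin_quot q i" using that by (rule one_le_sin_quot)
    moreover have "1 \<le> sin_quot q (Suc i) + sin_quot q i * (real k * lambda_q q)"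
      using calculation that assms one_le_of_nat_mult_lambda_q
      by (intro one_le_add_mult sin_quot_nonneg) auto
    ultimately show ?thesis by (simp only: mediant_row_components vector_2)
  qed
  then show ?thesis using False assms by (intro tree_edge_big) simp_all
qed

lemma tree_edge_mediant_column:
  assumes "1 \<le> k" "Suc j < q"
  shows "tree_edge (mediant q (vector [1, real k * lambda_q q]) e2 j)
    (mediant q (vector [1, real k * lambda_q q]) e2 (Suc j))"
    (is "tree_edge (?c j) (?c (Suc j))")
proof (cases "j = q - 2")
  case True
  have "Suc (q - 2) = q - 1" using three_le_q by simp
  moreover have "?c (q - 2) = vector [1, real (Suc k) * lambda_q q]"
    using mediant_q_minus_2 by (simp add: vec2_eq_iff distrib_right)
  ultimately show ?thesis using True mediant_last tree_edge_column[of "Suc k"] by simp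
next
  case False
  have "1 \<le> ?c i $ 1 \<and> 1 \<le> ?c i $ 2" if "i \<le> q - 2" for i
  proof -
    have "1 \<le> sin_quot q (Suc i)" using that three_le_q by (intro one_le_sin_quot) auto
    moreover have "1 \<le> sin_quot q i + sin_quot q (Suc i) * (real k * lambda_q q)"
      using calculation that assms one_le_of_nat_mult_lambda_q
      by (intro one_le_add_mult sin_quot_nonneg) auto
    ultimately show ?thesis by (simp only: mediant_column_components vector_2 add.commute)
  qed
  then show ?thesis using False assms by (intro tree_edge_big) simp_all
qed

lemma tree_edge_mediant_interior:
  assumes "1 \<le> v$1" "1 \<le> v$2" "1 \<le> w$1" "1 \<le> w$2" "Suc j < q"
  shows "tree_edge (mediant q v w j) (mediant q v w (Suc j))"
proof -
  have "1 \<le> mediant q v w i $ k" if "i < q" "1 \<le> v$k" "1 \<le> w$k" for i k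
  proof -
    have "sin_quot q (Suc i) * 1 + sin_quot q i * 1 \<le> mediant q v w i $ k"
      unfolding mediant_component using that sin_quot_nonneg[of i] sin_quot_nonneg[of "Suc i"]
      by (intro add_mono mult_left_mono) simp_all
    then show ?thesis using one_le_sin_quot_Suc_add[OF that(1)] by simp
  qed
  then show ?thesis using assms by (intro tree_edge_big) simp_all
qed

lemma tree_edge_mediant:
  assumes "tree_edge v w" "Suc j < q"
  shows "tree_edge (mediant q v w j) (mediant q v w (Suc j))"
  using assms(1)
  by (cases rule: tree_edge_cases)
    (use assms(2) tree_edge_mediant_e1_e2 tree_edge_mediant_row tree_edge_mediant_column
      tree_edge_mediant_interior in simp_all)

lemma tree_point_refine:
  assumes edges: "\<forall>(v, w)\<in>adj_pairs xs. tree_edge v w" and points: "\<forall>x\<in>set xs. tree_point x"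
    and len: "2 \<le> length xs" and x: "x \<in> set (refine q xs)"
  shows "tree_point x"
proof -
  obtain a b j where ab: "(a, b) \<in> adj_pairs xs" and j: "j < q" and x: "x = mediant q a b j"
    using x len by (rule set_refineE)
  have "tree_point a" "tree_point b" using adj_pairs_subset[OF ab] points by auto
  have "tree_edge a b" using ab edges by auto
  consider "j = 0" | "j = q - 1" | "1 \<le> j" "j \<le> q - 2" using j by linarith
  then show ?thesis
  proof cases
    case 1
    then show ?thesis using x \<open>tree_point a\<close> by simp
  next
    case 2
    then show ?thesis using x \<open>tree_point b\<close> mediant_last by simp
  next
    case 3
    then show ?thesis using x \<open>tree_edge a b\<close> tree_point_mediant by simp
  qed
qed

lemma SB_list_standard_shape:
  "(\<forall>(v, w)\<in>adj_pairs (SB_list q e1 e2 n). tree_edge v w)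
    \<and> (\<forall>x\<in>set (SB_list q e1 e2 n). tree_point x)"
proof (induction n)
  case 0
  have "tree_edge e1 e2" unfolding tree_edge_def by (intro disjI1 conjI refl)
  moreover have "tree_point e1" unfolding tree_point_def by (intro disjI1 refl)
  moreover have "tree_point e2" unfolding tree_point_def by (rule disjI2, intro disjI1 refl)
  ultimately show ?case by (simp add: SB_list_def)
next
  case (Suc n)
  have "tree_edge v w" if "(v, w) \<in> adj_pairs (SB_list q e1 e2 (Suc n))" for v w
    using that[unfolded SB_list_Suc] length_SB_list
  proof (rule adj_pairs_refineE)
    fix a b j
    assume "(a, b) \<in> adj_pairs (SB_list q e1 e2 n)" "Suc j < q"
      "v = mediant q a b j" "w = mediant q a b (Suc j)"
    then show "tree_edge v w" using Suc.IH tree_edge_mediant by blast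
  qed
  moreover have "tree_point x" if "x \<in> set (SB_list q e1 e2 (Suc n))" for x
    using Suc.IH length_SB_list that[unfolded SB_list_Suc] by (intro tree_point_refine) auto
  ultimately show ?case by blast
qed

lemma tree_point_sb_tree: "x \<in> sb_tree q e1 e2 \<Longrightarrow> tree_point x"
  using SB_list_standard_shape unfolding sb_tree_def by blast

lemma tree_point_nonneg:
  assumes "tree_point x"
  shows "0 \<le> x$1 \<and> 0 \<le> x$2"
  using assms
proof (cases rule: tree_point_cases)
  case (3 k)
  then show ?thesis using one_le_of_nat_mult_lambda_q[of k] by simp
next
  case (4 k)
  then show ?thesis using one_le_of_nat_mult_lambda_q[of k] by simp
qed simp_all

lemma tree_point_on_axes:
  assumes "tree_point x"
  shows "(x$2 = 0 \<longrightarrow> x = e1) \<and> (x$1 = 0 \<longrightarrow> x = e2)"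
  using assms
proof (cases rule: tree_point_cases)
  case (3 k)
  then show ?thesis using one_le_lambda_q by simp
next
  case (4 k)
  then show ?thesis using one_le_lambda_q by simp
qed simp_all

lemma tree_point_height_one:
  assumes "tree_point x"
  shows "(x$2 = 1 \<longrightarrow> (\<exists>k::nat. x$1 = real k * lambda_q q))
    \<and> (x$1 = 1 \<longrightarrow> (\<exists>k::nat. x$2 = real k * lambda_q q))"
  using assms
proof (cases rule: tree_point_cases)
  case 1
  then show ?thesis by simp
next
  case 2
  then show ?thesis by (auto intro: exI[of _ 0])
next
  case (3 k)
  then show ?thesis by (auto intro: exI[of _ k])
next
  case (4 k)
  then show ?thesis by (auto intro: exI[of _ k])
qed simp

subsection \<open>The rotated copies of the standard tree cover \<open>\<Lambda>\<^sub>q\<close>\<close>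

lemma U_mat_pow_q: "((*v) (U_mat q) ^^ q) v = - v"
proof -
  have "q = Suc (q - 1)" using three_le_q by simp
  then have "((*v) (U_mat q) ^^ q) v = v$1 *\<^sub>R xy_q q q - v$2 *\<^sub>R xy_q q (q - 1)"
    by (metis U_mat_pow_Suc)
  also have "\<dots> = - v"
    using sin_quot_q sin_quot_Suc_q sin_quot_q_minus_1 three_le_q
    by (simp add: vec2_eq_iff xy_q_eq)
  finally show ?thesis .
qed

lemma T_mat_sb_tree: "(*v) (T_mat q) ` sb_tree q e1 e2 \<subseteq> sb_tree q e1 e2"
proof -
  have "T_mat q *v e1 = mediant q e1 e2 0" "T_mat q *v e2 = mediant q e1 e2 (Suc 0)"
    using mediant_1 by (simp_all add: vec2_eq_iff T_mat_act)
  then have "(*v) (T_mat q) ` sb_tree q e1 e2 = sb_tree q (mediant q e1 e2 0) (mediant q e1 e2 (Suc 0))"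
    by (metis sb_tree_linear_image matrix_vector_mul_linear)
  also have "\<dots> \<subseteq> sb_tree q e1 e2"
    using three_le_q by (intro sb_tree_mediant_subset) simp
  finally show ?thesis .
qed

lemma U_mat_sb_tree:
  "(*v) (U_mat q) ` sb_tree q e1 e2 \<subseteq> sb_tree q e1 e2 \<union> (*v) S_mat ` sb_tree q e1 e2"
proof -
  let ?c = "mediant q e1 e2"
  have "(*v) (U_mat q) ` sb_tree q e1 e2 = sb_tree q (U_mat q *v e1) (U_mat q *v e2)"
    by (metis sb_tree_linear_image matrix_vector_mul_linear)
  also have "\<dots> = (\<Union>j\<in>{j. Suc j < q}. sb_tree q (?c (Suc j)) (?c (Suc (Suc j))))"
    by (subst sb_tree_unfold)
      (simp add: matrix_vector_mult_mediant[symmetric] mediant_e1_e2 xy_q_Suc)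
  also have "\<dots> \<subseteq> sb_tree q e1 e2 \<union> (*v) S_mat ` sb_tree q e1 e2"
  proof (intro UN_least, safe)
    fix j x assume j: "Suc j < q" and x: "x \<in> sb_tree q (?c (Suc j)) (?c (Suc (Suc j)))"
      and "x \<notin> (*v) S_mat ` sb_tree q e1 e2"
    show "x \<in> sb_tree q e1 e2"
    proof (cases "Suc (Suc j) < q")
      case True
      then show ?thesis using x sb_tree_mediant_subset by blast
    next
      case False
      then have "Suc j = q - 1" "Suc (Suc j) = q" using j by simp_all
      then have "?c (Suc j) = S_mat *v e1" "?c (Suc (Suc j)) = S_mat *v e2"
        using sin_quot_q sin_quot_Suc_q sin_quot_q_minus_1
        by (simp_all add: vec2_eq_iff mediant_component S_mat_act)
      then show ?thesis
        using x \<open>x \<notin> _\<close> by (metis sb_tree_linear_image matrix_vector_mul_linear)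
    qed
  qed
  finally show ?thesis .
qed

definition tree_orbit :: "(real^2) set" where
  "tree_orbit = sb_tree q e1 e2 \<union> (*v) S_mat ` sb_tree q e1 e2
     \<union> uminus ` sb_tree q e1 e2 \<union> uminus ` (*v) S_mat ` sb_tree q e1 e2"

lemma tree_orbit_uminus: "x \<in> tree_orbit \<Longrightarrow> - x \<in> tree_orbit"
  unfolding tree_orbit_def by auto

lemma tree_orbit_S_mat: "x \<in> tree_orbit \<Longrightarrow> S_mat *v x \<in> tree_orbit"
  unfolding tree_orbit_def by (auto simp: S_mat_S_mat_act S_mat_uminus_act)

lemma tree_orbit_cases:
  assumes "x \<in> tree_orbit"
  obtains y where "y \<in> sb_tree q e1 e2" "x = y"
    | y where "y \<in> sb_tree q e1 e2" "x = S_mat *v y"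
    | y where "y \<in> sb_tree q e1 e2" "x = - y"
    | y where "y \<in> sb_tree q e1 e2" "x = - (S_mat *v y)"
  using assms that unfolding tree_orbit_def by blast

lemma tree_orbit_U_mat:
  assumes "x \<in> tree_orbit"
  shows "U_mat q *v x \<in> tree_orbit"
proof -
  let ?T = "sb_tree q e1 e2"
  have U: "U_mat q *v y \<in> tree_orbit" if "y \<in> ?T" for y
    using U_mat_sb_tree that unfolding tree_orbit_def by blast
  have US: "U_mat q *v (S_mat *v y) \<in> tree_orbit" if "y \<in> ?T" for y
    using T_mat_sb_tree that unfolding tree_orbit_def U_mat_S_mat_act by blast
  from assms show ?thesis
    by (cases rule: tree_orbit_cases)
      (use U US tree_orbit_uminus in \<open>simp_all add: U_mat_uminus_act\<close>)
qed

lemma tree_orbit_U_mat_pow: "x \<in> tree_orbit \<Longrightarrow> ((*v) (U_mat q) ^^ n) x \<in> tree_orbit"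
  by (induction n) (simp_all add: tree_orbit_U_mat)

lemma tree_orbit_hecke_group:
  assumes "M \<in> hecke_group q" "x \<in> tree_orbit"
  shows "M *v x \<in> tree_orbit"
  using assms(1)
proof induction
  case id_in
  then show ?case using assms(2) by simp
next
  case (S_in M)
  then show ?case by (simp add: matrix_vector_mul_assoc[symmetric] tree_orbit_S_mat)
next
  case (S_inv_in M)
  have "matrix_inv S_mat *v y = S_mat *v (S_mat *v (S_mat *v y))" for y
    by (intro matrix_inv_vector_eqI invertible_S_mat) (simp add: S_mat_S_mat_act)
  then show ?case using S_inv_in by (simp add: matrix_vector_mul_assoc[symmetric] tree_orbit_S_mat)
next
  case (T_in M)
  have "T_mat q *v y = - (U_mat q *v (S_mat *v y))" for y by (simp add: U_mat_S_mat_act)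
  then show ?case
    using T_in by (simp add: matrix_vector_mul_assoc[symmetric] tree_orbit_S_mat tree_orbit_U_mat
        tree_orbit_uminus)
next
  case (T_inv_in M)
  \<comment> \<open>\<open>T\<^sup>-\<^sup>1 = - S U\<^sup>q\<^sup>-\<^sup>1\<close>, because \<open>T S = U\<close> and \<open>U\<^sup>q = -1\<close>\<close>
  have "matrix_inv (T_mat q) *v y = - (S_mat *v ((*v) (U_mat q) ^^ (q - 1)) y)" for y
  proof (intro matrix_inv_vector_eqI invertible_T_mat)
    have "q = Suc (q - 1)" using three_le_q by simp
    then have "U_mat q *v ((*v) (U_mat q) ^^ (q - 1)) y = - y"
      using U_mat_pow_q[of y] by (metis comp_apply funpow.simps(2))
    moreover have "T_mat q *v - (S_mat *v z) = - (U_mat q *v z)" for z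
      by (simp add: vec2_eq_iff T_mat_act S_mat_act U_mat_act)
    ultimately show "T_mat q *v - (S_mat *v ((*v) (U_mat q) ^^ (q - 1)) y) = y" by simp
  qed
  then show ?case
    using T_inv_in by (simp add: matrix_vector_mul_assoc[symmetric] tree_orbit_S_mat
        tree_orbit_U_mat_pow tree_orbit_uminus)
qed

lemma Lambda_q_subset_tree_orbit: "Lambda_q q \<subseteq> tree_orbit"
proof
  fix x assume "x \<in> Lambda_q q"
  then obtain M where "M \<in> hecke_group q" "x = M *v e1" unfolding Lambda_q_def by blast
  moreover have "e1 \<in> tree_orbit" unfolding tree_orbit_def using sb_tree_ends by blast
  ultimately show "x \<in> tree_orbit" using tree_orbit_hecke_group by blast
qed

lemma Lambda_q_first_quadrant:
  assumes "x \<in> Lambda_q q" "0 \<le> x$1" "0 \<le> x$2"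
  shows "x \<in> sb_tree q e1 e2"
proof -
  have "x \<in> tree_orbit" using assms(1) Lambda_q_subset_tree_orbit by blast
  then show ?thesis
  proof (cases rule: tree_orbit_cases)
    case (2 y)
    then have "y = e1" using assms tree_point_nonneg[of y] tree_point_on_axes[of y]
      by (simp add: tree_point_sb_tree S_mat_act)
    then have "x = e2" using 2 by (simp add: vec2_eq_iff S_mat_act)
    then show ?thesis using sb_tree_ends(2) by simp
  next
    case (3 y)
    then have "y = e2" using assms tree_point_nonneg[of y] tree_point_on_axes[of y]
      by (simp add: tree_point_sb_tree)
    then show ?thesis using 3 assms by simp
  next
    case (4 y)
    then have "y = e2" using assms tree_point_nonneg[of y] tree_point_on_axes[of y]
      by (simp add: tree_point_sb_tree S_mat_act)
    then have "x = e1" using 4 by (simp add: vec2_eq_iff S_mat_act)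
    then show ?thesis using sb_tree_ends(1) by simp
  qed simp
qed

lemma Lambda_q_height_one:
  assumes "x \<in> Lambda_q q" "x$2 = 1"
  shows "\<exists>k::int. x$1 = of_int k * lambda_q q"
proof -
  have "x \<in> tree_orbit" using assms(1) Lambda_q_subset_tree_orbit by blast
  then show ?thesis
  proof (cases rule: tree_orbit_cases)
    case (1 y)
    then obtain k :: nat where "x$1 = real k * lambda_q q"
      using assms tree_point_height_one[of y] by (auto simp: tree_point_sb_tree)
    then show ?thesis by (intro exI[of _ "int k"]) simp
  next
    case (2 y)
    then obtain k :: nat where "y$2 = real k * lambda_q q"
      using assms tree_point_height_one[of y] by (auto simp: tree_point_sb_tree S_mat_act)
    then show ?thesis using 2 by (intro exI[of _ "- int k"]) (simp add: S_mat_act)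
  next
    case (3 y)
    then show ?thesis using assms tree_point_nonneg[of y] by (simp add: tree_point_sb_tree)
  next
    case (4 y)
    then show ?thesis using assms tree_point_nonneg[of y] by (simp add: tree_point_sb_tree S_mat_act)
  qed
qed

subsection \<open>Unimodular pairs and the lists \<open>L\<^sub>n\<close>\<close>

lemma hecke_frame_if_unimodular:
  assumes "v \<in> Lambda_q q" "w \<in> Lambda_q q" "wedge v w = 1"
  shows "hecke_frame q v w"
proof -
  obtain M where M: "M \<in> hecke_group q" "v = M *v e1"
    using assms(1) unfolding Lambda_q_def by blast
  obtain N where N: "N \<in> hecke_group q" "N ** M = mat 1" "M ** N = mat 1"
    using hecke_group_inverse[OF M(1)] by blast
  define w' where "w' = N *v w"
  have "w' \<in> Lambda_q q" unfolding w'_def using N(1) assms(2) by (rule hecke_group_act_Lambda_q)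
  moreover have "wedge e1 w' = 1"
    using assms(3) wedge_matrix_vector_mult[of N v w] det_hecke_group[OF N(1)] N(2) M(2)
    by (simp add: w'_def matrix_vector_mul_assoc)
  then have "w'$2 = 1" by (simp add: wedge_def)
  ultimately obtain k where "w' = vector [of_int k * lambda_q q, 1]"
    using Lambda_q_height_one by (metis vec2_eq_iff vector_2)
  then obtain K where K: "K \<in> hecke_group q" "K *v e1 = e1" "K *v e2 = w'"
    using hecke_group_translation by metis
  have "M *v (N *v w) = w" using N(3) by (simp add: matrix_vector_mul_assoc)
  then have "(M ** K) *v e1 = v" "(M ** K) *v e2 = w"
    using K M by (simp_all add: matrix_vector_mul_assoc[symmetric] w'_def)
  then show ?thesis using hecke_group_mult[OF M(1) K(1)] unfolding hecke_frame_def by blast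
qed

lemma hecke_frame_SB_list:
  assumes "hecke_frame q u0 u1" "(v, w) \<in> adj_pairs (SB_list q u0 u1 n)"
  shows "hecke_frame q v w"
  using assms(2)
proof (induction n arbitrary: v w)
  case 0
  then show ?case using assms(1) by (simp add: SB_list_def)
next
  case (Suc n)
  from Suc.prems[unfolded SB_list_Suc] length_SB_list show ?case
  proof (rule adj_pairs_refineE)
    fix a b j
    assume "(a, b) \<in> adj_pairs (SB_list q u0 u1 n)" "v = mediant q a b j" "w = mediant q a b (Suc j)"
    then show "hecke_frame q v w" using Suc.IH hecke_frame_mediant by blast
  qed
qed

lemma set_SB_list_subset_sector: "set (SB_list q u0 u1 n) \<subseteq> sector u0 u1"
proof
  fix v assume "v \<in> set (SB_list q u0 u1 n)"
  define f where "f x = x$1 *\<^sub>R u0 + x$2 *\<^sub>R u1" for x :: "real^2"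
  have "linear f" unfolding f_def by (intro linearI) (simp_all add: algebra_simps)
  moreover have "f e1 = u0" "f e2 = u1" by (simp_all add: f_def)
  ultimately obtain x where x: "x \<in> set (SB_list q e1 e2 n)" "v = f x"
    using \<open>v \<in> _\<close> SB_list_linear_image by (metis imageE list.set_map)
  then have "0 \<le> x$1 \<and> 0 \<le> x$2"
    using SB_list_standard_shape tree_point_nonneg by blast
  then show "v \<in> sector u0 u1" unfolding sector_def x(2) f_def by blast
qed

lemma SB_list_Lambda_q_unimodular:
  assumes "hecke_frame q u0 u1"
  shows "\<forall>v\<in>set (SB_list q u0 u1 n). v \<in> Lambda_q q"
    and "\<forall>i. Suc i < length (SB_list q u0 u1 n) \<longrightarrow>
      wedge (SB_list q u0 u1 n ! i) (SB_list q u0 u1 n ! Suc i) = 1"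
proof -
  have frames: "hecke_frame q v w" if "(v, w) \<in> adj_pairs (SB_list q u0 u1 n)" for v w
    using assms that by (rule hecke_frame_SB_list)
  then show "\<forall>v\<in>set (SB_list q u0 u1 n). v \<in> Lambda_q q"
    using set_eq_adj_pairs[OF length_SB_list] hecke_frame_Lambda_q by blast
  show "\<forall>i. Suc i < length (SB_list q u0 u1 n) \<longrightarrow>
      wedge (SB_list q u0 u1 n ! i) (SB_list q u0 u1 n ! Suc i) = 1"
  proof (intro allI impI)
    fix i assume "Suc i < length (SB_list q u0 u1 n)"
    then have "(SB_list q u0 u1 n ! i, SB_list q u0 u1 n ! Suc i) \<in> adj_pairs (SB_list q u0 u1 n)"
      unfolding adj_pairs_conv_nth by blast
    then show "wedge (SB_list q u0 u1 n ! i) (SB_list q u0 u1 n ! Suc i) = 1"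
      using frames hecke_frame_Lambda_q(3) by blast
  qed
qed

lemma Lambda_q_sector_in_SB_list:
  assumes "hecke_frame q u0 u1" "v \<in> Lambda_q q" "v \<in> sector u0 u1"
  shows "\<exists>n. v \<in> set (SB_list q u0 u1 n)"
proof -
  obtain M where M: "M \<in> hecke_group q" "M *v e1 = u0" "M *v e2 = u1"
    using assms(1) unfolding hecke_frame_def by blast
  obtain N where N: "N \<in> hecke_group q" "N ** M = mat 1"
    using hecke_group_inverse[OF M(1)] by blast
  obtain a b where ab: "0 \<le> a" "0 \<le> b" "v = a *\<^sub>R u0 + b *\<^sub>R u1"
    using assms(3) unfolding sector_def by blast
  define x :: "real^2" where "x = vector [a, b]"
  have "M *v x = a *\<^sub>R u0 + b *\<^sub>R u1"
    using matrix_vector_mult_basis[of M x] M by (simp add: x_def)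
  then have v: "v = M *v x" using ab(3) by simp
  then have "x = N *v v" using N(2) by (simp add: matrix_vector_mul_assoc)
  then have "x \<in> Lambda_q q" using hecke_group_act_Lambda_q[OF N(1) assms(2)] by simp
  then have "x \<in> sb_tree q e1 e2" using ab by (intro Lambda_q_first_quadrant) (simp_all add: x_def)
  then obtain n where "x \<in> set (SB_list q e1 e2 n)" unfolding sb_tree_def by blast
  then have "v \<in> set (SB_list q (M *v e1) (M *v e2) n)"
    by (simp add: v SB_list_linear_image)
  then show ?thesis using M by blast
qed

end

theorem mainTheorem2:
  fixes q :: nat and u0 u1 :: "real^2"
  assumes "q \<ge> 3"
    and "u0 \<in> Lambda_q q" and "u1 \<in> Lambda_q q"
    and "wedge u0 u1 = 1"
  shows "(\<forall>n. (\<forall>v \<in> set (SB_list q u0 u1 n). v \<in> Lambda_q q \<and> v \<in> sector u0 u1)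
            \<and> (\<forall>i. Suc i < length (SB_list q u0 u1 n) \<longrightarrow>
                   wedge (SB_list q u0 u1 n ! i) (SB_list q u0 u1 n ! Suc i) = 1))
       \<and> (\<forall>v \<in> Lambda_q q. v \<in> sector u0 u1 \<longrightarrow> (\<exists>n. v \<in> set (SB_list q u0 u1 n)))"
proof -
  interpret hecke q using assms(1) by unfold_locales
  have frame: "hecke_frame q u0 u1"
    using assms(2-4) by (rule hecke_frame_if_unimodular)
  show ?thesis
    using SB_list_Lambda_q_unimodular[OF frame] set_SB_list_subset_sector
      Lambda_q_sector_in_SB_list[OF frame] by blast
qed

end
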